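(* Let $G$ be a second-countable locally compact amenable unimodular group with an irreducible, square-integrable projective unitary representation $(\pi, \mathcal{H}_{\pi})$ of formal degree $d_{\pi} > 0$. Let $\Lambda \subseteq G$ be locally finite and $g \in \mathcal{H}_{\pi}$. If $\pi(\Lambda) g$ satisfies the homogeneous approximation property (HAP), then $D^-(\Lambda) \geq d_{\pi}$.
   Context: Fix a Haar measure $\mu$ on $G$. A set $\Lambda \subseteq G$ is locally finite if it is closed and discrete, equivalently $\Lambda \cap K$ is finite for every compact $K \subseteq G$. Beurling density. A (right) strong Følner sequence in $G$ is a sequence $(K_n)_{n\in\mathbb{N}}$ of non-null compact sets such that for all compact $K \subseteq G$ one has $\mu(K_n \triangle K_nK)/\mu(K_n) \to 0$ and $\mu(K_nK \cap K_n^cK)/\mu(K_n) \to 0$ as $n \to \infty$, where $K_n^c = G \setminus K_n$. Such a sequence exists in every second-countable amenable group. The lower Beurling density is $D^-(\Lambda) = \liminf_{n\to\infty} \inf_{x\in G} |\Lambda \cap xK_n|/\mu(K_n)$; it does not depend on the choice of strong Følner sequence. Representations. A projective unitary representation of $G$ is a strongly continuous map $\pi: G \to \mathcal{U}(\mathcal{H}_\pi)$ into the unitary operators on a Hilbert space with $\pi(x)\pi(y) = \sigma(x,y)\pi(xy)$ for all $x,y\in G$, for some (2-cocycle) $\sigma: G\times G \to \mathbb{T}$. It is irreducible if $\{0\}$ and $\mathcal{H}_\pi$ are the only closed $\pi(G)$-invariant subspaces. An irreducible $\pi$ is square-integrable (a discrete series) if there is a non-zero $g \in \mathcal{H}_\pi$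 with $\int_G |\langle g,\pi(x)g\rangle|^2\,d\mu(x) < \infty$; then its formal degree is the number $d_\pi > 0$ such that $\int_G |\langle f,\pi(x)g\rangle|^2\,d\mu(x) = d_\pi^{-1}\|f\|^2\|g\|^2$ for all $f,g\in\mathcal{H}_\pi$ (same Haar measure $\mu$ as in the density). Homogeneous approximation property. $\pi(\Lambda)g$ denotes the family $(\pi(\lambda)g)_{\lambda\in\Lambda}$. For $S \subseteq \mathcal{H}_\pi$, $\operatorname{dist}(f,S) = \inf_{h\in S}\|f-h\|$. A family $(g_\lambda)_{\lambda\in\Lambda}$ of vectors in $\mathcal{H}_\pi$ indexed by a countable set $\Lambda \subseteq G$ satisfies the HAP if for every $f\in\mathcal{H}_\pi$ and $\varepsilon>0$ there is a compact neighborhood $K$ of the identity of $G$ such that $\operatorname{dist}\big(\pi(x)f, \operatorname{span}\{g_\lambda : \lambda\in\Lambda\cap xK\}\big) < \varepsilon$ for all $x\in G$. *)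

theory Defs
  imports "HOL-Analysis.Analysis"
begin

section \<open>Complex Hilbert spaces\<close>

text \<open>The underlying real Hilbert space structure supplies the norm, the topology and completeness;
  by polarization the last axiom forces the real inner product to be the real part of
  \<open>cinner\<close>.\<close>

class complex_hilbert_space = real_inner + complete_space +
  fixes scaleC :: "complex \<Rightarrow> 'a \<Rightarrow> 'a"
    and cinner :: "'a \<Rightarrow> 'a \<Rightarrow> complex"
  assumes scaleC_add_right: "scaleC a (x + y) = scaleC a x + scaleC a y"
    and scaleC_add_left: "scaleC (a + b) x = scaleC a x + scaleC b x"
    and scaleC_scaleC: "scaleC a (scaleC b x) = scaleC (a * b) x"
    and scaleR_scaleC: "scaleR r x = scaleC (complex_of_real r) x"
    and cinner_commute: "cinner x y = cnj (cinner y x)"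
    and cinner_add_left: "cinner (x + y) z = cinner x z + cinner y z"
    and cinner_scaleC_left: "cinner (scaleC a x) y = a * cinner x y"
    and cinner_self: "cinner x x = complex_of_real ((norm x)\<^sup>2)"

instantiation complex :: complex_hilbert_space
begin

definition scaleC_complex :: "complex \<Rightarrow> complex \<Rightarrow> complex"
  where "scaleC_complex a x = a * x"

definition cinner_complex :: "complex \<Rightarrow> complex \<Rightarrow> complex"
  where "cinner_complex x y = x * cnj y"

instance
proof
  fix a b x y z :: complex and r :: real
  show "scaleC a (x + y) = scaleC a x + scaleC a y"
    by (simp only: scaleC_complex_def distrib_left)
  show "scaleC (a + b) x = scaleC a x + scaleC b x"
    by (simp only: scaleC_complex_def distrib_right)
  show "scaleC a (scaleC b x) = scaleC (a * b) x"
    by (simp only: scaleC_complex_def mult.assoc)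
  show "scaleR r x = scaleC (complex_of_real r) x"
    by (simp only: scaleC_complex_def scaleR_conv_of_real)
  show "cinner x y = cnj (cinner y x)"
    by (simp only: cinner_complex_def complex_cnj_mult complex_cnj_cnj mult.commute)
  show "cinner (x + y) z = cinner x z + cinner y z"
    by (simp only: cinner_complex_def distrib_right)
  show "cinner (scaleC a x) y = a * cinner x y"
    by (simp only: cinner_complex_def scaleC_complex_def mult.assoc)
  show "cinner x x = complex_of_real ((norm x)\<^sup>2)"
    by (simp only: cinner_complex_def complex_norm_square)
qed

end

lemma scaleC_one: "scaleC 1 (x :: 'a::complex_hilbert_space) = x"
  by (metis of_real_1 scaleR_one scaleR_scaleC)

global_interpretation complex_vector:
  vector_space "scaleC :: complex \<Rightarrow> 'a \<Rightarrow> 'a::complex_hilbert_space"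
  by standard (rule scaleC_add_right scaleC_add_left scaleC_scaleC scaleC_one)+

definition unitary :: "('h::complex_hilbert_space \<Rightarrow> 'h) \<Rightarrow> bool" where
  "unitary U \<longleftrightarrow> Vector_Spaces.linear scaleC scaleC U \<and> surj U \<and>
     (\<forall>u v. cinner (U u) (U v) = cinner u v)"


section \<open>Groups, Haar measure and amenability\<close>

text \<open>Groups are written additively, as in the library class \<^class>\<open>topological_group_add\<close>, but are
  \<^emph>\<open>not\<close> assumed commutative: \<open>x + y\<close> stands for the product \<open>xy\<close>, \<open>- x\<close> for the inverse,
  \<open>0\<close> for the identity, and \<open>A + B\<close> for the product set \<open>AB\<close>.\<close>

definition radon_measure :: "'a::t2_space measure \<Rightarrow> bool" where
  "radon_measure \<mu> \<longleftrightarrow> sets \<mu> = sets borel \<and>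
     (\<forall>K. compact K \<longrightarrow> emeasure \<mu> K < \<infinity>) \<and>
     (\<forall>A\<in>sets borel. emeasure \<mu> A = (INF U\<in>{U. open U \<and> A \<subseteq> U}. emeasure \<mu> U)) \<and>
     (\<forall>U. open U \<longrightarrow> emeasure \<mu> U = (SUP K\<in>{K. compact K \<and> K \<subseteq> U}. emeasure \<mu> K))"

definition haar_measure :: "'g::{topological_group_add, t2_space} measure \<Rightarrow> bool" where
  "haar_measure \<mu> \<longleftrightarrow> radon_measure \<mu> \<and> emeasure \<mu> UNIV \<noteq> 0 \<and>
     (\<forall>x. \<forall>A\<in>sets borel. emeasure \<mu> ((\<lambda>y. x + y) ` A) = emeasure \<mu> A)"

text \<open>Unimodularity of the group, expressed through a given left Haar measure \<open>\<mu>\<close>; by uniqueness of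
  Haar measure the choice is immaterial. The same applies to \<open>amenable\<close>, which only depends on
  the null sets of \<open>\<mu>\<close>.\<close>

definition unimodular :: "'g::{topological_group_add, t2_space} measure \<Rightarrow> bool" where
  "unimodular \<mu> \<longleftrightarrow> (\<forall>x. \<forall>A\<in>sets borel. emeasure \<mu> ((\<lambda>y. y + x) ` A) = emeasure \<mu> A)"

definition ess_bounded :: "'a measure \<Rightarrow> ('a \<Rightarrow> real) set" where
  "ess_bounded \<mu> = {f \<in> borel_measurable \<mu>. \<exists>C. AE x in \<mu>. \<bar>f x\<bar> \<le> C}"

text \<open>A left-invariant mean on \<open>L\<^sup>\<infinity>(G, \<mu>)\<close>, given on representatives: additivity and
  positivity force \<open>m\<close> to take equal values on functions that agree almost everywhere.\<close>

definition left_invariant_mean ::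
  "'g::{topological_group_add, t2_space} measure \<Rightarrow> (('g \<Rightarrow> real) \<Rightarrow> real) \<Rightarrow> bool" where
  "left_invariant_mean \<mu> m \<longleftrightarrow>
     (\<forall>f\<in>ess_bounded \<mu>. \<forall>h\<in>ess_bounded \<mu>. m (\<lambda>y. f y + h y) = m f + m h) \<and>
     (\<forall>f\<in>ess_bounded \<mu>. \<forall>c. m (\<lambda>y. c * f y) = c * m f) \<and>
     (\<forall>f\<in>ess_bounded \<mu>. (AE y in \<mu>. 0 \<le> f y) \<longrightarrow> 0 \<le> m f) \<and>
     m (\<lambda>y. 1) = 1 \<and>
     (\<forall>f\<in>ess_bounded \<mu>. \<forall>x. m (\<lambda>y. f (x + y)) = m f)"

definition amenable :: "'g::{topological_group_add, t2_space} measure \<Rightarrow> bool" where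
  "amenable \<mu> \<longleftrightarrow> (\<exists>m. left_invariant_mean \<mu> m)"


section \<open>Beurling density\<close>

definition locally_finite :: "'g::topological_space set \<Rightarrow> bool" where
  "locally_finite \<Lambda> \<longleftrightarrow> closed \<Lambda> \<and> discrete \<Lambda>"

text \<open>The test sets \<open>C\<close> have to be non-empty: for \<open>C = {}\<close> the first quotient is constantly \<open>1\<close>.\<close>

definition strong_folner_sequence ::
  "'g::{topological_group_add, t2_space} measure \<Rightarrow> (nat \<Rightarrow> 'g set) \<Rightarrow> bool" where
  "strong_folner_sequence \<mu> K \<longleftrightarrow>
     (\<forall>n. compact (K n) \<and> emeasure \<mu> (K n) \<noteq> 0) \<and>
     (\<forall>C. compact C \<longrightarrow> C \<noteq> {} \<longrightarrow>
        (\<lambda>n. measure \<mu> (sym_diff (K n) (K n + C)) / measure \<mu> (K n)) \<longlonglongrightarrow> 0 \<and>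
        (\<lambda>n. measure \<mu> ((K n + C) \<inter> (- K n + C)) / measure \<mu> (K n)) \<longlonglongrightarrow> 0)"

text \<open>The density is taken along a given strong Folner sequence \<open>K\<close> and is independent of it. It may
  be infinite. For locally finite \<open>\<Lambda>\<close> and compact \<open>K n\<close> the counted sets are finite, so
  \<^const>\<open>card\<close> is the true cardinality.\<close>

definition lower_beurling_density ::
  "'g::{topological_group_add, t2_space} measure \<Rightarrow> (nat \<Rightarrow> 'g set) \<Rightarrow> 'g set \<Rightarrow> ereal" where
  "lower_beurling_density \<mu> K \<Lambda> =
     liminf (\<lambda>n. INF x. ereal (real (card (\<Lambda> \<inter> (\<lambda>y. x + y) ` K n)) / measure \<mu> (K n)))"


section \<open>Projective unitary representations\<close>

definition two_cocycle :: "('g::group_add \<Rightarrow> 'g \<Rightarrow> complex) \<Rightarrow> bool" where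
  "two_cocycle \<sigma> \<longleftrightarrow> (\<forall>x y. cmod (\<sigma> x y) = 1) \<and>
     (\<forall>x y z. \<sigma> x y * \<sigma> (x + y) z = \<sigma> x (y + z) * \<sigma> y z)"

definition projective_unitary_rep ::
  "('g::topological_group_add \<Rightarrow> 'h::complex_hilbert_space \<Rightarrow> 'h) \<Rightarrow> bool" where
  "projective_unitary_rep \<pi> \<longleftrightarrow>
     (\<forall>x. unitary (\<pi> x)) \<and>
     (\<forall>v. continuous_on UNIV (\<lambda>x. \<pi> x v)) \<and>
     (\<exists>\<sigma>. two_cocycle \<sigma> \<and> (\<forall>x y v. \<pi> x (\<pi> y v) = scaleC (\<sigma> x y) (\<pi> (x + y) v)))"

definition irreducible_rep ::
  "('g \<Rightarrow> 'h::complex_hilbert_space \<Rightarrow> 'h) \<Rightarrow> bool" where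
  "irreducible_rep \<pi> \<longleftrightarrow>
     (\<forall>V. complex_vector.subspace V \<and> closed V \<and> (\<forall>x. \<pi> x ` V \<subseteq> V) \<longrightarrow> V = {0} \<or> V = UNIV)"

definition square_integrable_rep ::
  "'g measure \<Rightarrow> ('g \<Rightarrow> 'h::complex_hilbert_space \<Rightarrow> 'h) \<Rightarrow> bool" where
  "square_integrable_rep \<mu> \<pi> \<longleftrightarrow>
     (\<exists>g. g \<noteq> 0 \<and> (\<integral>\<^sup>+ x. ennreal ((cmod (cinner g (\<pi> x g)))\<^sup>2) \<partial>\<mu>) < \<infinity>)"

definition is_formal_degree ::
  "'g measure \<Rightarrow> ('g \<Rightarrow> 'h::complex_hilbert_space \<Rightarrow> 'h) \<Rightarrow> real \<Rightarrow> bool" where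
  "is_formal_degree \<mu> \<pi> d \<longleftrightarrow> d > 0 \<and>
     (\<forall>f g. (\<integral>\<^sup>+ x. ennreal ((cmod (cinner f (\<pi> x g)))\<^sup>2) \<partial>\<mu>)
            = ennreal (inverse d * (norm f)\<^sup>2 * (norm g)\<^sup>2))"


section \<open>Homogeneous approximation property\<close>

definition HAP ::
  "('g::topological_group_add \<Rightarrow> 'h::complex_hilbert_space \<Rightarrow> 'h) \<Rightarrow> 'g set \<Rightarrow> ('g \<Rightarrow> 'h) \<Rightarrow> bool"
where
  "HAP \<pi> \<Lambda> \<gamma> \<longleftrightarrow>
     (\<forall>f. \<forall>\<epsilon>>0. \<exists>K. compact K \<and> 0 \<in> interior K \<and>
        (\<forall>x. infdist (\<pi> x f) (complex_vector.span (\<gamma> ` (\<Lambda> \<inter> (\<lambda>y. x + y) ` K))) < \<epsilon>))"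

end

theory Submission
  imports Defs
begin

text \<open>If \<open>x + C \<subseteq> y + K n\<close>, with \<open>C\<close> the compact set of the HAP for a unit vector \<open>f\<close>, then
  \<open>\<pi> x f\<close> is \<open>\<epsilon>\<close>-close to the span \<open>V\<close> of the \<open>\<pi> \<lambda> g\<close> with \<open>\<lambda> \<in> \<Lambda> \<inter> (y + K n)\<close>, so the
  orthogonal projection of \<open>\<pi> x f\<close> to \<open>V\<close> has squared norm at least \<open>1 - \<epsilon>\<^sup>2\<close>. By the
  orthogonality relations the integral of this squared norm over \<open>x\<close> is \<open>dim V / d\<close>, which is at
  most \<open>|\<Lambda> \<inter> (y + K n)| / d\<close>. The Folner condition says that the set of such \<open>x\<close> fills out
  \<open>y + K n\<close> asymptotically.\<close>

section \<open>Orthonormal systems in complex Hilbert spaces\<close>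

lemma cinner_add_right: "cinner (x :: 'a::complex_hilbert_space) (y + z) = cinner x y + cinner x z"
  by (metis cinner_add_left cinner_commute complex_cnj_add)

lemma cinner_scaleC_right: "cinner (x :: 'a::complex_hilbert_space) (scaleC a y) = cnj a * cinner x y"
  by (metis cinner_scaleC_left cinner_commute complex_cnj_mult)

lemma cinner_minus_left: "cinner (- x :: 'a::complex_hilbert_space) y = - cinner x y"
  by (metis cinner_scaleC_left complex_vector.scale_minus_left mult_minus1 scaleC_one)

lemma cinner_diff_left: "cinner (x - y :: 'a::complex_hilbert_space) z = cinner x z - cinner y z"
  using cinner_add_left[of x "- y" z] by (simp add: cinner_minus_left)

lemma cinner_zero_left [simp]: "cinner (0 :: 'a::complex_hilbert_space) y = 0"
  using cinner_diff_left[of 0 0 y] by simp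

lemma cinner_zero_right [simp]: "cinner (y :: 'a::complex_hilbert_space) 0 = 0"
  by (metis cinner_commute cinner_zero_left complex_cnj_zero)

lemma cinner_sum_left:
  "cinner (\<Sum>i\<in>I. f i :: 'a::complex_hilbert_space) y = (\<Sum>i\<in>I. cinner (f i) y)"
  by (induction I rule: infinite_finite_induct) (auto simp: cinner_add_left)

text \<open>Polarization: \<open>cinner\<close> and \<open>inner\<close> induce the same norm, so
  expanding the squared norm of \<open>x + y\<close> through either one identifies the cross terms.
  This makes facts about real inner product spaces available for \<open>cinner\<close>.\<close>

lemma Re_cinner: "Re (cinner x y) = inner (x :: 'a::complex_hilbert_space) y"
proof -
  have "cinner (x + y) (x + y) = cinner x x + cinner y y + (cinner x y + cnj (cinner x y))"
    by (simp add: cinner_add_left cinner_add_right cinner_commute[of y x])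
  hence "Re (cinner (x + y) (x + y)) = Re (cinner x x + cinner y y + (cinner x y + cnj (cinner x y)))"
    by simp
  hence "(norm (x + y))\<^sup>2 = (norm x)\<^sup>2 + (norm y)\<^sup>2 + 2 * Re (cinner x y)"
    by (simp add: cinner_self)
  moreover have "(norm (x + y))\<^sup>2 = (norm x)\<^sup>2 + (norm y)\<^sup>2 + 2 * inner x y"
    by (simp add: power2_norm_eq_inner inner_add_left inner_add_right inner_commute)
  ultimately show ?thesis by simp
qed

lemma Im_cinner: "Im (cinner x y) = inner (x :: 'a::complex_hilbert_space) (scaleC \<i> y)"
  by (simp add: Re_cinner[symmetric] cinner_scaleC_right)

text \<open>Continuity is inherited from \<open>inner\<close>: the real and imaginary parts are real
  inner products, with \<open>y\<close> and with \<open>scaleC \<i> y\<close>.\<close>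

lemma continuous_on_cinner_left [continuous_intros]:
  fixes f :: "'b::topological_space \<Rightarrow> 'a::complex_hilbert_space"
  assumes "continuous_on A f"
  shows "continuous_on A (\<lambda>x. cinner (f x) y)"
proof -
  have "continuous_on A (\<lambda>x. Complex (inner (f x) y) (inner (f x) (scaleC \<i> y)))"
    unfolding Complex_eq by (intro continuous_intros assms)
  moreover have "Complex (inner u y) (inner u (scaleC \<i> y)) = cinner u y" for u :: 'a
    by (simp add: complex_eq_iff Re_cinner Im_cinner)
  ultimately show ?thesis by simp
qed

section \<open>Finite orthonormal systems and orthogonal projection\<close>

definition orthonormal :: "'a::complex_hilbert_space set \<Rightarrow> bool" where
  "orthonormal B \<longleftrightarrow> (\<forall>b\<in>B. \<forall>c\<in>B. cinner b c = (if b = c then 1 else 0))"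

text \<open>This is the orthogonal projection to the span when \<open>B\<close> is finite and
  orthonormal; for infinite \<open>B\<close> the sum is 0 by default.\<close>

definition proj_on :: "'a::complex_hilbert_space set \<Rightarrow> 'a \<Rightarrow> 'a" where
  "proj_on B v = (\<Sum>b\<in>B. scaleC (cinner v b) b)"

lemma proj_on_in_span: "proj_on B v \<in> complex_vector.span B"
  unfolding proj_on_def
  by (intro complex_vector.span_sum complex_vector.span_scale complex_vector.span_base)

lemma cinner_proj_on_base:
  assumes "finite B" "orthonormal B" "b \<in> B"
  shows "cinner (proj_on B v) b = cinner v b"
proof -
  have "cinner (proj_on B v) b = (\<Sum>c\<in>B. cinner v c * (if c = b then 1 else 0))"
    unfolding proj_on_def cinner_sum_left cinner_scaleC_left
    using assms by (intro sum.cong) (auto simp: orthonormal_def)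
  also have "\<dots> = cinner v b"
    using assms by (simp add: if_distrib cong: if_cong)
  finally show ?thesis .
qed

lemma cinner_span_eq_0:
  assumes "h \<in> complex_vector.span B" "\<And>b. b \<in> B \<Longrightarrow> cinner u b = 0"
  shows "cinner u h = 0"
  using assms(1)
  by (induction rule: complex_vector.span_induct_alt)
     (auto simp: cinner_add_right cinner_scaleC_right assms(2))

lemma cinner_diff_proj_on:
  assumes "finite B" "orthonormal B" "h \<in> complex_vector.span B"
  shows "cinner (v - proj_on B v) h = 0"
  using assms(3)
  by (rule cinner_span_eq_0) (simp add: cinner_diff_left cinner_proj_on_base[OF assms(1,2)])

text \<open>Gram-Schmidt by induction. A vector whose residual \<open>u\<close> against the current
  system vanishes is dropped, so \<open>S\<close> may be linearly dependent and
  \<open>card B\<close> may be smaller than \<open>card S\<close>.\<close>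

lemma gram_schmidt:
  fixes S :: "'a::complex_hilbert_space set"
  assumes "finite S"
  obtains B where "finite B" "card B \<le> card S" "orthonormal B"
    "complex_vector.span S \<subseteq> complex_vector.span B"
proof -
  from assms have "\<exists>B. finite B \<and> card B \<le> card S \<and> orthonormal B \<and>
    complex_vector.span S \<subseteq> complex_vector.span B"
  proof (induction S rule: finite_induct)
    case empty
    show ?case by (intro exI[of _ "{}"]) (auto simp: orthonormal_def)
  next
    case (insert v S)
    then obtain B where B: "finite B" "card B \<le> card S" "orthonormal B"
      "complex_vector.span S \<subseteq> complex_vector.span B" by blast
    define u where "u = v - proj_on B v"
    show ?case
    proof (cases "u = 0")
      case True
      hence "v \<in> complex_vector.span B" by (metis u_def proj_on_in_span eq_iff_diff_eq_0)
      moreover have "S \<subseteq> complex_vector.span B"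
        using B(4) complex_vector.span_superset by blast
      ultimately have "complex_vector.span (insert v S) \<subseteq> complex_vector.span B"
        by (intro complex_vector.span_minimal) auto
      with B insert.hyps show ?thesis by (intro exI[of _ B]) auto
    next
      case False
      define e where "e = scaleC (complex_of_real (inverse (norm u))) u"
      have ee: "cinner e e = 1"
        using False unfolding e_def cinner_scaleC_left cinner_scaleC_right
        by (subst cinner_self) (simp add: power2_eq_square field_simps)
      have eb: "cinner e b = 0" if "b \<in> B" for b
        using cinner_diff_proj_on[OF B(1,3) complex_vector.span_base[OF that]]
        by (simp add: e_def u_def cinner_scaleC_left)
      have be: "cinner b e = 0" if "b \<in> B" for b
        using eb[OF that] by (metis cinner_commute complex_cnj_zero)
      have orth: "orthonormal (insert e B)"
        using B(3) ee eb be unfolding orthonormal_def by auto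
      have sub: "complex_vector.span B \<subseteq> complex_vector.span (insert e B)"
        by (intro complex_vector.span_mono) auto
      have "u = scaleC (complex_of_real (norm u)) e"
        using False by (simp add: e_def scaleC_scaleC scaleC_one flip: of_real_mult)
      hence "u \<in> complex_vector.span (insert e B)"
        by (metis complex_vector.span_base complex_vector.span_scale insertI1)
      moreover have "v = u + proj_on B v" by (simp add: u_def)
      ultimately have "v \<in> complex_vector.span (insert e B)"
        using sub proj_on_in_span by (metis complex_vector.span_add subsetD)
      moreover have "S \<subseteq> complex_vector.span (insert e B)"
        using B(4) sub complex_vector.span_superset by blast
      ultimately have "complex_vector.span (insert v S) \<subseteq> complex_vector.span (insert e B)"
        by (intro complex_vector.span_minimal) auto
      moreover have "card (insert e B) \<le> card (insert v S)"
        using B(1,2) insert.hyps by (simp add: card_insert_if)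
      ultimately show ?thesis using B(1) orth by (intro exI[of _ "insert e B"]) auto
    qed
  qed
  thus ?thesis using that by blast
qed

lemma norm_add_orthogonal:
  fixes u w :: "'a::complex_hilbert_space"
  assumes "cinner u w = 0"
  shows "(norm (u + w))\<^sup>2 = (norm u)\<^sup>2 + (norm w)\<^sup>2"
proof -
  have "inner u w = 0" using assms by (simp add: Re_cinner[symmetric])
  thus ?thesis by (simp add: power2_norm_eq_inner inner_add_left inner_add_right inner_commute)
qed

text \<open>Pythagoras twice, with \<open>p\<close> the projection of \<open>v\<close>: once for
  \<open>v = (v - p) + p\<close>, and once for \<open>v - h = (v - p) + (p - h)\<close>, which shows
  that \<open>h\<close> is no closer to \<open>v\<close> than \<open>p\<close> is. The sum is the
  squared norm of \<open>p\<close> by Parseval.\<close>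

lemma norm_diff_sq_ge:
  fixes v h :: "'a::complex_hilbert_space"
  assumes B: "finite B" "orthonormal B" and h: "h \<in> complex_vector.span B"
  shows "(norm v)\<^sup>2 \<le> (norm (v - h))\<^sup>2 + (\<Sum>b\<in>B. (cmod (cinner v b))\<^sup>2)"
proof -
  let ?p = "proj_on B v"
  have "(norm ((v - ?p) + ?p))\<^sup>2 = (norm (v - ?p))\<^sup>2 + (norm ?p)\<^sup>2"
    by (intro norm_add_orthogonal cinner_diff_proj_on B proj_on_in_span)
  moreover have "(norm ((v - ?p) + (?p - h)))\<^sup>2 = (norm (v - ?p))\<^sup>2 + (norm (?p - h))\<^sup>2"
    by (intro norm_add_orthogonal cinner_diff_proj_on B proj_on_in_span
        complex_vector.span_diff h)
  moreover have "(norm ?p)\<^sup>2 = (\<Sum>b\<in>B. (cmod (cinner v b))\<^sup>2)"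
  proof -
    have "complex_of_real ((norm ?p)\<^sup>2) = cinner ?p ?p" by (simp add: cinner_self)
    \<comment> \<open>Only the left factor is expanded; \<open>v\<close> and its projection have the
      same coefficients against \<open>B\<close>, which evaluates the right one.\<close>
    also have "\<dots> = (\<Sum>b\<in>B. cinner v b * cinner b ?p)"
      unfolding proj_on_def[of B v] cinner_sum_left cinner_scaleC_left by simp
    also have "\<dots> = (\<Sum>b\<in>B. cinner v b * cnj (cinner v b))"
      by (intro sum.cong refl) (metis cinner_commute cinner_proj_on_base B)
    also have "\<dots> = complex_of_real (\<Sum>b\<in>B. (cmod (cinner v b))\<^sup>2)"
      by (simp only: of_real_sum complex_norm_square)
    finally show ?thesis by (simp only: of_real_eq_iff)
  qed
  ultimately show ?thesis by simp
qed

section \<open>Translates and product sets\<close>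

lemma compact_set_plus:
  fixes A B :: "'g::topological_monoid_add set"
  assumes "compact A" "compact B"
  shows "compact (A + B)"
proof -
  have "compact ((\<lambda>(x, y). x + y) ` (A \<times> B))"
    using assms unfolding case_prod_beta
    by (intro compact_continuous_image compact_Times continuous_intros)
  also have "(\<lambda>(x, y). x + y) ` (A \<times> B) = A + B"
    by (auto simp: set_plus_def)
  finally show ?thesis .
qed

text \<open>A union of right translates of \<open>A\<close>. For \<open>A\<close> the complement of
  a Folner set it yields measurability of the boundary set.\<close>

lemma open_set_plus_left:
  fixes A B :: "'g::topological_group_add set"
  assumes "open A"
  shows "open (A + B)"
proof -
  have "A + B = (\<Union>b\<in>B. (\<lambda>x. x - b) -` A)"
    by (auto simp: set_plus_def) (metis add_diff_cancel diff_add_cancel)+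
  also have "open \<dots>"
    by (intro open_UN ballI open_vimage assms continuous_intros)
  finally show ?thesis .
qed

lemma closed_right_core:
  fixes A C :: "'g::topological_group_add set"
  assumes "closed A"
  shows "closed {x. (\<lambda>c. x + c) ` C \<subseteq> A}"
proof -
  have "{x. (\<lambda>c. x + c) ` C \<subseteq> A} = (\<Inter>c\<in>C. (\<lambda>x. x + c) -` A)" by auto
  also have "closed \<dots>"
    by (intro closed_INT ballI closed_vimage assms continuous_intros)
  finally show ?thesis .
qed

text \<open>A point \<open>x\<close> of \<open>A\<close> with \<open>x + c\<close> outside
  \<open>A\<close> is both \<open>x + 0\<close> and \<open>(x + c) + (- c)\<close>, so it lies in
  the boundary set of the second Folner condition for \<open>C'\<close>. Adjoining 0 serves the
  first representation and keeps \<open>C'\<close> non-empty, as that condition demands.\<close>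

lemma diff_right_core_subset:
  fixes A C :: "'g::group_add set"
  defines "C' \<equiv> insert 0 (uminus ` C)"
  shows "A - {x. (\<lambda>c. x + c) ` C \<subseteq> A} \<subseteq> (A + C') \<inter> (- A + C')"
proof
  fix x assume "x \<in> A - {x. (\<lambda>c. x + c) ` C \<subseteq> A}"
  then obtain c where x: "x \<in> A" "c \<in> C" "x + c \<notin> A" by auto
  have "x = x + 0" "x = (x + c) + (- c)" by (simp_all add: add.assoc)
  moreover have "0 \<in> C'" "- c \<in> C'" using x by (auto simp: C'_def)
  ultimately show "x \<in> (A + C') \<inter> (- A + C')"
    using x by (metis ComplI IntI set_plus_intro)
qed

text \<open>Closedness of \<open>\<Lambda>\<close> makes the intersection compact, and a compact
  discrete set is finite.\<close>

lemma finite_locally_finite_Int_compact: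
  fixes \<Lambda> :: "'g::t2_space set"
  assumes "locally_finite \<Lambda>" "compact A"
  shows "finite (\<Lambda> \<inter> A)"
proof -
  have "compact (\<Lambda> \<inter> A)"
    using assms by (auto simp: locally_finite_def intro: closed_Int_compact)
  moreover have "discrete (\<Lambda> \<inter> A)"
    using assms(1) unfolding locally_finite_def discrete_def isolated_in_islimpt_iff
    by (auto dest: islimpt_subset[OF _ Int_lower1])
  ultimately show ?thesis by (simp flip: discrete_compact_finite_iff)
qed

section \<open>The density bound\<close>

text \<open>Each \<open>b\<close> contributes \<open>inverse d\<close> by the formal degree
  identity, after conjugate symmetry has moved \<open>\<pi> x f\<close> to the second slot. For
  infinite \<open>B\<close> both sides are 0, by the defaults of the sum and of
  \<open>card\<close>.\<close>

lemma nn_integral_orthonormal: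
  fixes \<pi> :: "'g::{topological_group_add, t2_space} \<Rightarrow> 'h::complex_hilbert_space \<Rightarrow> 'h"
  assumes "sets \<mu> = sets borel" "continuous_on UNIV (\<lambda>x. \<pi> x f)" "is_formal_degree \<mu> \<pi> d"
    and "orthonormal B" "norm f = 1"
  shows "(\<integral>\<^sup>+ x. ennreal (\<Sum>b\<in>B. (cmod (cinner (\<pi> x f) b))\<^sup>2) \<partial>\<mu>) = ennreal (card B / d)"
proof -
  have meas: "(\<lambda>x. cinner (\<pi> x f) b) \<in> borel_measurable \<mu>" for b
    using borel_measurable_continuous_onI[OF continuous_on_cinner_left[OF assms(2)]]
    by (simp add: measurable_cong_sets[OF assms(1) refl])
  have d: "d > 0" using assms(3) by (simp add: is_formal_degree_def)
  have nb: "(norm b)\<^sup>2 = 1" if "b \<in> B" for b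
  proof -
    have "complex_of_real ((norm b)\<^sup>2) = 1"
      using that assms(4) by (metis cinner_self orthonormal_def)
    thus ?thesis by (simp only: of_real_eq_1_iff)
  qed
  have orth: "(\<integral>\<^sup>+ x. ennreal ((cmod (cinner (\<pi> x f) b))\<^sup>2) \<partial>\<mu>) = ennreal (inverse d)"
    if "b \<in> B" for b
  proof -
    have "(\<integral>\<^sup>+ x. ennreal ((cmod (cinner (\<pi> x f) b))\<^sup>2) \<partial>\<mu>)
        = (\<integral>\<^sup>+ x. ennreal ((cmod (cinner b (\<pi> x f)))\<^sup>2) \<partial>\<mu>)"
      by (metis cinner_commute complex_mod_cnj)
    also have "\<dots> = ennreal (inverse d * (norm b)\<^sup>2 * (norm f)\<^sup>2)"
      using assms(3) unfolding is_formal_degree_def by blast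
    finally show ?thesis by (simp add: nb[OF that] assms(5))
  qed
  have "(\<integral>\<^sup>+ x. ennreal (\<Sum>b\<in>B. (cmod (cinner (\<pi> x f) b))\<^sup>2) \<partial>\<mu>)
      = (\<integral>\<^sup>+ x. (\<Sum>b\<in>B. ennreal ((cmod (cinner (\<pi> x f) b))\<^sup>2)) \<partial>\<mu>)"
    by (simp add: sum_ennreal)
  also have "\<dots> = (\<Sum>b\<in>B. \<integral>\<^sup>+ x. ennreal ((cmod (cinner (\<pi> x f) b))\<^sup>2) \<partial>\<mu>)"
    by (rule nn_integral_sum) (use meas in simp)
  also have "\<dots> = (\<Sum>b\<in>B. ennreal (inverse d))"
    by (rule sum.cong[OF refl orth])
  also have "\<dots> = ennreal (card B / d)"
    using d by (simp add: ennreal_of_nat_eq_real_of_nat ennreal_mult[symmetric] divide_inverse)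
  finally show ?thesis .
qed

text \<open>The squared norm of the projection of \<open>\<pi> x f\<close> to the span of
  \<open>B\<close> is at least \<open>1 - \<epsilon>\<^sup>2\<close> on \<open>A\<close>, while its
  integral over the whole group is \<open>card B / d\<close>.\<close>

lemma card_ge_measure:
  fixes \<pi> :: "'g::{topological_group_add, t2_space} \<Rightarrow> 'h::complex_hilbert_space \<Rightarrow> 'h"
  assumes \<mu>: "sets \<mu> = sets borel" and cont: "continuous_on UNIV (\<lambda>x. \<pi> x f)"
    and deg: "is_formal_degree \<mu> \<pi> d" and f: "norm f = 1"
    and A: "A \<in> sets \<mu>" and S: "finite S" and \<epsilon>: "0 < \<epsilon>" "\<epsilon> < 1"
    and near: "\<And>x. x \<in> A \<Longrightarrow> norm (\<pi> x f) = 1 \<and> infdist (\<pi> x f) (complex_vector.span S) < \<epsilon>"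
  shows "d * (1 - \<epsilon>\<^sup>2) * measure \<mu> A \<le> card S"
proof -
  obtain B where B: "finite B" "card B \<le> card S" "orthonormal B"
      "complex_vector.span S \<subseteq> complex_vector.span B"
    by (rule gram_schmidt[OF S])
  have d: "d > 0" using deg by (simp add: is_formal_degree_def)
  have \<epsilon>2: "1 - \<epsilon>\<^sup>2 > 0" using \<epsilon> by (simp add: abs_square_less_1)
  have low: "1 - \<epsilon>\<^sup>2 \<le> (\<Sum>b\<in>B. (cmod (cinner (\<pi> x f) b))\<^sup>2)" if "x \<in> A" for x
  proof -
    \<comment> \<open>The strict bound on the infimum provides an actual point \<open>h\<close> of
      the span. Non-emptiness matters, since \<open>infdist\<close> to the empty set is 0 by
      default.\<close>
    have "complex_vector.span S \<noteq> {}" using complex_vector.span_zero by blast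
    hence "\<exists>h\<in>complex_vector.span S. dist (\<pi> x f) h < \<epsilon>"
      using near[OF that] cINF_greatest[of "complex_vector.span S" \<epsilon> "dist (\<pi> x f)"]
      by (force simp: infdist_def not_less)
    then obtain h where h: "h \<in> complex_vector.span S" "dist (\<pi> x f) h < \<epsilon>" by blast
    have "(norm (\<pi> x f))\<^sup>2 \<le> (norm (\<pi> x f - h))\<^sup>2 + (\<Sum>b\<in>B. (cmod (cinner (\<pi> x f) b))\<^sup>2)"
      using B h by (intro norm_diff_sq_ge) auto
    moreover have "(norm (\<pi> x f - h))\<^sup>2 \<le> \<epsilon>\<^sup>2"
      using h by (intro power_mono) (auto simp: dist_norm)
    ultimately show ?thesis using near[OF that] by simp
  qed
  have "ennreal (1 - \<epsilon>\<^sup>2) * emeasure \<mu> A = (\<integral>\<^sup>+ x. ennreal (1 - \<epsilon>\<^sup>2) * indicator A x \<partial>\<mu>)"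
    using A by (simp add: nn_integral_cmult_indicator)
  also have "\<dots> \<le> (\<integral>\<^sup>+ x. ennreal (\<Sum>b\<in>B. (cmod (cinner (\<pi> x f) b))\<^sup>2) \<partial>\<mu>)"
    by (intro nn_integral_mono) (auto simp: indicator_def intro!: ennreal_leI low)
  also have "\<dots> = ennreal (card B / d)"
    by (rule nn_integral_orthonormal[OF \<mu> cont deg B(3) f])
  \<comment> \<open>The right side is finite and \<open>1 - \<epsilon>\<^sup>2\<close> is positive,
    so \<open>A\<close> has finite measure and the inequality passes to the reals.\<close>
  finally have "enn2real (ennreal (1 - \<epsilon>\<^sup>2) * emeasure \<mu> A) \<le> enn2real (ennreal (card B / d))"
    by (intro enn2real_mono) auto
  hence "(1 - \<epsilon>\<^sup>2) * measure \<mu> A \<le> card B / d"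
    using \<epsilon>2 d by (simp add: enn2real_mult measure_def)
  hence "d * ((1 - \<epsilon>\<^sup>2) * measure \<mu> A) \<le> card B"
    using d by (simp add: field_simps)
  thus ?thesis using B(2) by (simp add: mult.assoc)
qed

theorem theorem1p2:
  fixes \<mu> :: "'g::{topological_group_add, t2_space, second_countable_topology} measure"
    and \<pi> :: "'g \<Rightarrow> 'h::complex_hilbert_space \<Rightarrow> 'h"
    and d :: real and \<Lambda> :: "'g set" and g :: 'h and K :: "nat \<Rightarrow> 'g set"
  assumes "locally compact (UNIV :: 'g set)"
    and "haar_measure \<mu>"
    and "unimodular \<mu>"
    and "amenable \<mu>"
    and "projective_unitary_rep \<pi>"
    and "irreducible_rep \<pi>"
    and "square_integrable_rep \<mu> \<pi>"
    and "is_formal_degree \<mu> \<pi> d"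
    and "locally_finite \<Lambda>"
    and "HAP \<pi> \<Lambda> (\<lambda>l. \<pi> l g)"
    and "strong_folner_sequence \<mu> K"
  shows "lower_beurling_density \<mu> K \<Lambda> \<ge> ereal d"
proof -
  note haar = assms(2)[unfolded haar_measure_def radon_measure_def]
  note folner = assms(11)[unfolded strong_folner_sequence_def]
  have sets\<mu>: "sets \<mu> = sets borel"
    by (rule conjunct1[OF conjunct1[OF haar]])
  have fin: "emeasure \<mu> C < \<infinity>" if "compact C" for C
    using conjunct1[OF conjunct2[OF conjunct1[OF haar]]] that by simp
  have inv: "emeasure \<mu> ((\<lambda>y. x + y) ` A) = emeasure \<mu> A" if "A \<in> sets borel" for x A
    using conjunct2[OF conjunct2[OF haar]] that by simp
  have K: "compact (K n)" and K0: "emeasure \<mu> (K n) \<noteq> 0" for n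
    using conjunct1[OF folner] by simp_all
  \<comment> \<open>\<open>measure\<close> defaults to 0 where \<open>emeasure\<close> is infinite,
    so compactness of \<open>K n\<close> enters together with non-nullness.\<close>
  have Kpos: "measure \<mu> (K n) > 0" for n
    using K0[of n] fin[OF K[of n]] by (simp add: measure_def enn2real_positive_iff zero_less_iff_neq_zero)
  have cont: "continuous_on UNIV (\<lambda>x. \<pi> x f)" for f
    using assms(5) by (simp add: projective_unitary_rep_def)
  have norm\<pi>: "norm (\<pi> x f) = norm f" for x f
  proof -
    have "cinner (\<pi> x f) (\<pi> x f) = cinner f f"
      using assms(5) by (simp add: projective_unitary_rep_def unitary_def)
    hence "(norm (\<pi> x f))\<^sup>2 = (norm f)\<^sup>2" by (simp only: cinner_self of_real_eq_iff)
    thus ?thesis by simp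
  qed
  have d: "d > 0" using assms(8) by (simp add: is_formal_degree_def)
  \<comment> \<open>Any unit vector can be the one to approximate; it is unrelated to
    \<open>g\<close>. Square-integrability supplies a non-zero vector.\<close>
  obtain f0 :: 'h where "f0 \<noteq> 0" using assms(7) by (auto simp: square_integrable_rep_def)
  define f where "f = scaleR (inverse (norm f0)) f0"
  have f: "norm f = 1" using \<open>f0 \<noteq> 0\<close> by (simp add: f_def)

  \<comment> \<open>The bound with a loss of \<open>\<epsilon>\<^sup>2\<close>, which is removed in
    the limit at the end.\<close>
  have bound: "ereal (d * (1 - \<epsilon>\<^sup>2)) \<le> lower_beurling_density \<mu> K \<Lambda>" if \<epsilon>: "0 < \<epsilon>" "\<epsilon> < 1" for \<epsilon> :: real
  proof -
    have \<epsilon>2: "1 - \<epsilon>\<^sup>2 > 0" using \<epsilon> by (simp add: abs_square_less_1)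
    obtain C where C: "compact C" and
      near: "\<And>x. infdist (\<pi> x f) (complex_vector.span ((\<lambda>l. \<pi> l g) ` (\<Lambda> \<inter> (\<lambda>y. x + y) ` C))) < \<epsilon>"
      using assms(10) \<epsilon>(1) unfolding HAP_def by meson
    define C' where "C' = insert 0 (uminus ` C)"
    have C': "compact C'"
      unfolding C'_def using C
      by (intro compact_insert compact_continuous_image continuous_intros)
    \<comment> \<open>The relative size of the Folner boundary of \<open>K n\<close> for
      \<open>C'\<close>; it does not depend on the translate of \<open>K n\<close>
      considered.\<close>
    define r where "r n = measure \<mu> ((K n + C') \<inter> (- K n + C')) / measure \<mu> (K n)" for n
    have "C' \<noteq> {}" by (simp add: C'_def)
    with C' have r: "r \<longlonglongrightarrow> 0"
      using conjunct2[OF folner] unfolding r_def by simp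
    \<comment> \<open>The points whose whole HAP window stays inside \<open>K n\<close>.
      Intersecting with \<open>K n\<close> below gives a compact set.\<close>
    define A where "A n = {x. (\<lambda>c. x + c) ` C \<subseteq> K n}" for n
    have Acl: "closed (A n)" for n
      unfolding A_def by (intro closed_right_core compact_imp_closed K)
    have Ky: "compact ((\<lambda>z. y + z) ` K n)" for y n
      by (intro compact_continuous_image continuous_intros K)
    \<comment> \<open>What is cut from \<open>K n\<close> lies in the boundary set, by
      \<open>diff_right_core_subset\<close>.\<close>
    have core: "(1 - r n) * measure \<mu> (K n) \<le> measure \<mu> (A n \<inter> K n)" for n
    proof -
      have fm: "K n \<in> fmeasurable \<mu>"
        by (intro fmeasurableI fin K) (simp add: sets\<mu> borel_compact K)
      \<comment> \<open>Comparing values of \<open>measure\<close> needs finiteness: the first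
        factor is compact, the second open because \<open>- K n\<close> is.\<close>
      have fm2: "(K n + C') \<inter> (- K n + C') \<in> fmeasurable \<mu>"
      proof (rule fmeasurableI2[of "K n + C'"])
        have "compact (K n + C')" by (intro compact_set_plus K C')
        thus "K n + C' \<in> fmeasurable \<mu>"
          by (intro fmeasurableI fin) (simp_all add: sets\<mu> borel_compact)
        have "open (- K n + C')"
          by (intro open_set_plus_left open_Compl compact_imp_closed K)
        with \<open>compact (K n + C')\<close> show "(K n + C') \<inter> (- K n + C') \<in> sets \<mu>"
          by (simp add: sets\<mu> borel_compact sets.Int)
      qed auto
      have AK: "A n \<inter> K n \<in> fmeasurable \<mu>"
        using Acl[of n] K[of n] by (intro fmeasurableI2[OF fm]) (auto simp: sets\<mu> intro!: sets.Int borel_compact)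
      have "measure \<mu> (K n) - measure \<mu> (A n \<inter> K n) = measure \<mu> (K n - A n \<inter> K n)"
        using measurable_measure_Diff[OF fm fmeasurableD[OF AK]] by simp
      also have "\<dots> \<le> measure \<mu> ((K n + C') \<inter> (- K n + C'))"
        using diff_right_core_subset[of "K n" C] fm AK
        by (intro measure_mono_fmeasurable[OF _ _ fm2]) (auto simp: A_def C'_def)
      also have "\<dots> = r n * measure \<mu> (K n)" using Kpos[of n] by (simp add: r_def)
      finally show ?thesis by (simp add: algebra_simps)
    qed
    \<comment> \<open>The left side is free of \<open>y\<close>, so the estimate survives the
      infimum over all translates.\<close>
    have est: "d * (1 - \<epsilon>\<^sup>2) * (1 - r n) \<le> card (\<Lambda> \<inter> (\<lambda>z. y + z) ` K n) / measure \<mu> (K n)" for y n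
    proof -
      let ?S = "\<Lambda> \<inter> (\<lambda>z. y + z) ` K n"
      let ?A = "(\<lambda>z. y + z) ` (A n \<inter> K n)"
      have finS: "finite ?S"
        by (intro finite_locally_finite_Int_compact assms Ky)
      have comp: "compact (A n \<inter> K n)" using Acl K by (intro closed_Int_compact)
      have "compact ?A"
        by (intro compact_continuous_image continuous_intros comp)
      hence Am: "?A \<in> sets \<mu>" by (simp add: sets\<mu> borel_compact)
      have "d * (1 - \<epsilon>\<^sup>2) * measure \<mu> ?A \<le> card ((\<lambda>l. \<pi> l g) ` ?S)"
      proof (rule card_ge_measure[where f = f and \<pi> = \<pi>])
        fix x assume "x \<in> ?A"
        then obtain a where "x = y + a" "(\<lambda>c. a + c) ` C \<subseteq> K n" by (auto simp: A_def)
        \<comment> \<open>Windows are added on the right and \<open>y\<close> on the left, so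
          associativity alone carries the inclusion over to the translate.\<close>
        hence "(\<lambda>c. x + c) ` C \<subseteq> (\<lambda>z. y + z) ` K n"
          by (auto simp: add.assoc)
        hence "complex_vector.span ((\<lambda>l. \<pi> l g) ` (\<Lambda> \<inter> (\<lambda>c. x + c) ` C))
            \<subseteq> complex_vector.span ((\<lambda>l. \<pi> l g) ` ?S)"
          by (intro complex_vector.span_mono image_mono) auto
        hence "infdist (\<pi> x f) (complex_vector.span ((\<lambda>l. \<pi> l g) ` ?S))
            \<le> infdist (\<pi> x f) (complex_vector.span ((\<lambda>l. \<pi> l g) ` (\<Lambda> \<inter> (\<lambda>c. x + c) ` C)))"
          using complex_vector.span_zero by (intro infdist_mono) blast+
        with near[of x] show "norm (\<pi> x f) = 1 \<and>
            infdist (\<pi> x f) (complex_vector.span ((\<lambda>l. \<pi> l g) ` ?S)) < \<epsilon>"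
          by (simp add: norm\<pi> f)
      qed (use sets\<mu> cont assms(8) f Am finS \<epsilon> in auto)
      \<comment> \<open>Distinct points of \<open>\<Lambda>\<close> may give the same vector, so
        this is only an inequality.\<close>
      also have "\<dots> \<le> real (card ?S)" using finS by (simp add: card_image_le)
      also have "measure \<mu> ?A = measure \<mu> (A n \<inter> K n)"
        using inv[of "A n \<inter> K n" y] comp by (simp add: measure_def borel_compact)
      finally have "d * (1 - \<epsilon>\<^sup>2) * measure \<mu> (A n \<inter> K n) \<le> card ?S" .
      moreover have "d * (1 - \<epsilon>\<^sup>2) * ((1 - r n) * measure \<mu> (K n)) \<le> d * (1 - \<epsilon>\<^sup>2) * measure \<mu> (A n \<inter> K n)"
        using core[of n] d \<epsilon>2 by (intro mult_left_mono) auto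
      ultimately show ?thesis using Kpos[of n] by (simp add: field_simps)
    qed
    have "(\<lambda>n. ereal (d * (1 - \<epsilon>\<^sup>2) * (1 - r n))) \<longlonglongrightarrow> ereal (d * (1 - \<epsilon>\<^sup>2) * (1 - 0))"
      by (intro tendsto_intros r)
    hence "ereal (d * (1 - \<epsilon>\<^sup>2)) = liminf (\<lambda>n. ereal (d * (1 - \<epsilon>\<^sup>2) * (1 - r n)))"
      using lim_imp_Liminf[OF sequentially_bot] by force
    also have "\<dots> \<le> lower_beurling_density \<mu> K \<Lambda>"
      unfolding lower_beurling_density_def
      by (intro Liminf_mono always_eventually allI INF_greatest) (simp add: est)
    finally show ?thesis .
  qed
  \<comment> \<open>Let \<open>\<epsilon>\<close> tend to 0 from the right. The limit is taken in
    \<open>ereal\<close>, where the density may be infinite.\<close>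
  have "((\<lambda>\<epsilon>. ereal (d * (1 - \<epsilon>\<^sup>2))) \<longlongrightarrow> ereal (d * (1 - 0\<^sup>2))) (at_right (0::real))"
    by (intro tendsto_intros)
  moreover have "eventually (\<lambda>\<epsilon>. ereal (d * (1 - \<epsilon>\<^sup>2)) \<le> lower_beurling_density \<mu> K \<Lambda>) (at_right (0::real))"
    using eventually_at_right_real[OF zero_less_one] by (rule eventually_mono) (simp add: bound)
  ultimately have "ereal (d * (1 - 0\<^sup>2)) \<le> lower_beurling_density \<mu> K \<Lambda>"
    by (rule tendsto_upperbound) simp
  thus ?thesis by simp
qed

end
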